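(* Let $X$ be a topological space, let $n\in\mathbb{N}$, and let $\alpha\in H_n(X;\mathbb{Z})$ be a singular homology class. Then the following are equivalent: (1) The class $\alpha$ is weakly flexible with respect to the functor $H_n(\,\cdot\,;\mathbb{Z})\colon\mathsf{Top}\to\mathsf{Ab}$. (2) The sequence $\bigl(\|d\cdot\alpha\|_{1,\mathbb{Z}}\bigr)_{d\in\mathbb{N}}$ contains a bounded (infinite) subsequence.
   Context: $\mathbb{N}$ contains $0$. The class $\alpha\in H_n(X;\mathbb{Z})$ is weakly flexible with respect to $H_n(\,\cdot\,;\mathbb{Z})$ if there exist a topological space $Y$ and a class $\beta\in H_n(Y;\mathbb{Z})$ such that the set $D(\beta,\alpha)=\{d\in\mathbb{Z}\mid \exists f\colon Y\to X \text{ continuous}:\ H_n(f;\mathbb{Z})(\beta)=d\cdot\alpha\}$ is infinite. For $\gamma\in H_n(X;\mathbb{Z})$ the integral $\ell^1$-semi-norm is $$\|\gamma\|_{1,\mathbb{Z}}=\inf\Bigl\{\sum_{j=0}^k|a_j| \Bigm| \sum_{j=0}^k a_j\cdot\sigma_j\in C_n(X;\mathbb{Z})\text{ is a singular cycle representing }\gamma\Bigr\},$$ where $|\cdot|$ is the usual absolute value on $\mathbb{Z}$. *)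

theory Defs
  imports "HOL-Homology.Homology"
begin

definition chain_l1_norm :: "'a chain \<Rightarrow> int" where
  "chain_l1_norm c = (\<Sum>\<sigma>\<in>Poly_Mapping.keys c. \<bar>Poly_Mapping.lookup c \<sigma>\<bar>)"

(* A homology class is a coset of the boundaries; the coset of a cycle c is
   homologous_rel_set n X {} c, so the cycles below are exactly those representing \<gamma>. *)
definition integral_l1_seminorm :: "nat \<Rightarrow> 'a topology \<Rightarrow> 'a chain set \<Rightarrow> real" where
  "integral_l1_seminorm n X \<gamma> =
     Inf {real_of_int (chain_l1_norm c) | c.
            singular_relcycle n X {} c \<and> homologous_rel_set n X {} c = \<gamma>}"

(* The homology groups are written multiplicatively: \<alpha> [^] d is the multiple d \<cdot> \<alpha>. *)
definition mapping_degrees ::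
  "nat \<Rightarrow> 'y topology \<Rightarrow> 'y chain set \<Rightarrow> 'a topology \<Rightarrow> 'a chain set \<Rightarrow> int set" where
  "mapping_degrees n Y \<beta> X \<alpha> =
     {d. \<exists>f. continuous_map Y X f \<and>
             hom_induced (int n) Y {} X {} f \<beta> = \<alpha> [^]\<^bsub>homology_group (int n) X\<^esub> d}"

(* HOL cannot quantify existentially over types, so the type 'y from which the points of
   the space Y are taken is a parameter.  A free type variable 'y in a hypothesis
   weakly_flexible TYPE('y) ranges over all types, so it covers arbitrary spaces Y; for a
   conclusion, a concrete type such as nat \<Rightarrow> real exhibits where Y can be found. *)
definition weakly_flexible ::
  "'y itself \<Rightarrow> nat \<Rightarrow> 'a topology \<Rightarrow> 'a chain set \<Rightarrow> bool" where
  "weakly_flexible (_ :: 'y itself) n X \<alpha> \<longleftrightarrow>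
     (\<exists>(Y :: 'y topology) \<beta>. \<beta> \<in> carrier (homology_group (int n) Y) \<and>
        infinite (mapping_degrees n Y \<beta> X \<alpha>))"

definition has_bounded_subsequence :: "(nat \<Rightarrow> real) \<Rightarrow> bool" where
  "has_bounded_subsequence s \<longleftrightarrow> (\<exists>r :: nat \<Rightarrow> nat. strict_mono r \<and> Bseq (s \<circ> r))"

end

theory Submission
  imports Defs
begin

text \<open>
  A continuous map does not increase the l1-norm of a cycle, so one cycle representing \<open>\<beta>\<close> bounds
  the norms of all multiples \<open>d \<cdot> \<alpha>\<close> with \<open>d \<in> D(\<beta>, \<alpha>)\<close>. Conversely, cycles of bounded norm that
  represent infinitely many multiples of \<open>\<alpha>\<close> have only finitely many combinatorial types (number
  of simplices, coefficients, coincidences between faces), so infinitely many of them share one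
  type. Gluing simplices according to all these cycles at once gives a space with a single cycle
  that maps onto each of them.
\<close>

section \<open>The integral l1-norm of chains and classes\<close>

lemma chain_l1_norm_superset:
  assumes "finite A" "Poly_Mapping.keys c \<subseteq> A"
  shows "chain_l1_norm c = (\<Sum>\<sigma>\<in>A. \<bar>Poly_Mapping.lookup c \<sigma>\<bar>)"
  unfolding chain_l1_norm_def
  by (rule sum.mono_neutral_left) (use assms in \<open>auto simp: in_keys_iff\<close>)

lemma chain_l1_norm_nonneg [simp]: "0 \<le> chain_l1_norm c"
  by (simp add: chain_l1_norm_def sum_nonneg)

lemma chain_l1_norm_zero [simp]: "chain_l1_norm 0 = 0"
  by (simp add: chain_l1_norm_def)

lemma chain_l1_norm_minus [simp]: "chain_l1_norm (- c) = chain_l1_norm c"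
  by (simp add: chain_l1_norm_def)

lemma chain_l1_norm_add_le: "chain_l1_norm (c + d) \<le> chain_l1_norm c + chain_l1_norm d"
proof -
  let ?A = "Poly_Mapping.keys c \<union> Poly_Mapping.keys d"
  have "chain_l1_norm (c + d) = (\<Sum>\<sigma>\<in>?A. \<bar>Poly_Mapping.lookup (c + d) \<sigma>\<bar>)"
    by (intro chain_l1_norm_superset keys_add) auto
  also have "\<dots> \<le> (\<Sum>\<sigma>\<in>?A. \<bar>Poly_Mapping.lookup c \<sigma>\<bar> + \<bar>Poly_Mapping.lookup d \<sigma>\<bar>)"
    by (intro sum_mono) (simp add: lookup_add)
  also have "\<dots> = chain_l1_norm c + chain_l1_norm d"
    by (simp add: sum.distrib chain_l1_norm_superset[of ?A c] chain_l1_norm_superset[of ?A d])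
  finally show ?thesis .
qed

lemma chain_l1_norm_sum_le:
  "chain_l1_norm (\<Sum>i\<in>I. f i) \<le> (\<Sum>i\<in>I. chain_l1_norm (f i))"
proof (induction I rule: infinite_finite_induct)
  case (insert i I)
  then show ?case
    using chain_l1_norm_add_le[of "f i" "\<Sum>i\<in>I. f i"] by simp
qed simp_all

lemma chain_l1_norm_cmul_of: "chain_l1_norm (frag_cmul a (frag_of \<sigma>)) = \<bar>a\<bar>"
  by (subst chain_l1_norm_superset[of "{\<sigma>}"])
    (use keys_cmul[of a "frag_of \<sigma>"] in auto)

text \<open>Distinct simplices can have the same image and their coefficients can cancel there, so
  the triangle inequality yields only an upper bound.\<close>

lemma chain_l1_norm_chain_map_le: "chain_l1_norm (chain_map p f c) \<le> chain_l1_norm c"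
proof -
  have "chain_l1_norm (chain_map p f c)
      \<le> (\<Sum>\<sigma>\<in>Poly_Mapping.keys c.
            chain_l1_norm (frag_cmul (Poly_Mapping.lookup c \<sigma>) (frag_of (simplex_map p f \<sigma>))))"
    unfolding chain_map_def frag_extend_def o_def by (rule chain_l1_norm_sum_le)
  also have "\<dots> = chain_l1_norm c"
    by (simp only: chain_l1_norm_cmul_of) (simp only: chain_l1_norm_def)
  finally show ?thesis .
qed

section \<open>The seminorm as an infimum over representing cycles\<close>

lemma bdd_below_chain_l1_norm:
  "bdd_below {real_of_int (chain_l1_norm c) | c. P c}"
  by (rule bdd_belowI[of _ 0]) auto

lemma integral_l1_seminorm_le:
  assumes "singular_relcycle n X {} c" "homologous_rel_set n X {} c = \<gamma>"
  shows "integral_l1_seminorm n X \<gamma> \<le> chain_l1_norm c"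
  unfolding integral_l1_seminorm_def
  using assms by (intro cInf_lower bdd_below_chain_l1_norm) auto

text \<open>\<open>Inf\<close> on the reals is only informative for nonempty sets bounded below;
  membership in the homology group supplies a representative.\<close>

lemma norm_representatives_nonempty:
  assumes "\<gamma> \<in> carrier (homology_group (int n) X)"
  shows "{real_of_int (chain_l1_norm c) | c.
            singular_relcycle n X {} c \<and> homologous_rel_set n X {} c = \<gamma>} \<noteq> {}"
  using assms by (auto simp: carrier_relative_homology_group)

lemma integral_l1_seminorm_nonneg:
  assumes "\<gamma> \<in> carrier (homology_group (int n) X)"
  shows "0 \<le> integral_l1_seminorm n X \<gamma>"
  unfolding integral_l1_seminorm_def
  by (rule cInf_greatest[OF norm_representatives_nonempty[OF assms]]) auto

lemma integral_l1_seminorm_lessD: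
  assumes "\<gamma> \<in> carrier (homology_group (int n) X)" "integral_l1_seminorm n X \<gamma> < K"
  obtains c where "singular_relcycle n X {} c" "homologous_rel_set n X {} c = \<gamma>"
    "real_of_int (chain_l1_norm c) < K"
  using cInf_lessD[OF norm_representatives_nonempty[OF assms(1)]] assms(2)
  unfolding integral_l1_seminorm_def by blast

text \<open>Negating a representing cycle keeps its norm and represents the inverse class; the slack
  \<open>e\<close> allows a nearly optimal cycle to be used.\<close>

lemma integral_l1_seminorm_inv_le:
  assumes "\<gamma> \<in> carrier (homology_group (int n) X)"
  shows "integral_l1_seminorm n X (inv\<^bsub>homology_group (int n) X\<^esub> \<gamma>)
       \<le> integral_l1_seminorm n X \<gamma>"
proof (rule field_le_epsilon)
  fix e :: real assume "e > 0"
  then obtain c where c: "singular_relcycle n X {} c" "homologous_rel_set n X {} c = \<gamma>"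
    and less: "real_of_int (chain_l1_norm c) < integral_l1_seminorm n X \<gamma> + e"
    using integral_l1_seminorm_lessD[OF assms, of "integral_l1_seminorm n X \<gamma> + e"] by auto
  have minus: "singular_relcycle n X {} (- c)"
    using c by (simp add: singular_relcycle_minus)
  \<comment> \<open>The inverse coset comes as an image under negation and has to be recognised as
    the coset of \<open>- c\<close>.\<close>
  have "inv\<^bsub>homology_group (int n) X\<^esub> \<gamma> = uminus ` homologous_rel_set n X {} c"
    using inv_relative_homology_group[OF assms] c by simp
  also have "\<dots> = homologous_rel_set n X {} (- c)"
  proof (intro subset_antisym subsetI)
    fix x assume "x \<in> uminus ` homologous_rel_set n X {} c"
    then show "x \<in> homologous_rel_set n X {} (- c)"
      by (auto simp: homologous_rel_def) (metis minus_diff_eq singular_relboundary_minus)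
  next
    fix x assume "x \<in> homologous_rel_set n X {} (- c)"
    then have "- x \<in> homologous_rel_set n X {} c"
      using singular_relboundary_minus[of n X "{}" "c + x"]
      by (simp add: homologous_rel_def add.commute)
    then show "x \<in> uminus ` homologous_rel_set n X {} c"
      by (metis image_eqI minus_minus)
  qed
  finally have "integral_l1_seminorm n X (inv\<^bsub>homology_group (int n) X\<^esub> \<gamma>) \<le> chain_l1_norm (- c)"
    using integral_l1_seminorm_le[OF minus] by simp
  then show "integral_l1_seminorm n X (inv\<^bsub>homology_group (int n) X\<^esub> \<gamma>)
       \<le> integral_l1_seminorm n X \<gamma> + e"
    using less by simp
qed

section \<open>Weak flexibility bounds multiples\<close>

text \<open>Mapping degrees are integers while the sequence is indexed by natural numbers; passing
  to inverse classes handles negative degrees.\<close>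

lemma integral_l1_seminorm_pow_nat_abs_le:
  assumes "\<alpha> \<in> carrier (homology_group (int n) X)"
  shows "integral_l1_seminorm n X (\<alpha> [^]\<^bsub>homology_group (int n) X\<^esub> nat \<bar>d\<bar>)
       \<le> integral_l1_seminorm n X (\<alpha> [^]\<^bsub>homology_group (int n) X\<^esub> d)"
proof -
  let ?G = "homology_group (int n) X"
  interpret group ?G by simp
  \<comment> \<open>The exponent is a natural number on the left and an integer on the right, so two
    overloads of \<open>[^]\<close> are identified here.\<close>
  have eq: "\<alpha> [^]\<^bsub>?G\<^esub> nat \<bar>d\<bar> = \<alpha> [^]\<^bsub>?G\<^esub> \<bar>d\<bar>"
    by (simp flip: int_pow_int)
  show ?thesis
    using integral_l1_seminorm_inv_le[OF int_pow_closed[OF assms, of d]] assms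
    by (cases "d \<ge> 0") (simp_all add: eq int_pow_neg)
qed

lemma weakly_flexible_imp_bounded_subsequence:
  assumes \<alpha>: "\<alpha> \<in> carrier (homology_group (int n) X)"
    and flex: "weakly_flexible TYPE('y) n X \<alpha>"
  shows "has_bounded_subsequence
           (\<lambda>d. integral_l1_seminorm n X (\<alpha> [^]\<^bsub>homology_group (int n) X\<^esub> d))"
proof -
  let ?G = "homology_group (int n) X"
  interpret group ?G by simp
  obtain Y :: "'y topology" and \<beta> where \<beta>: "\<beta> \<in> carrier (homology_group (int n) Y)"
    and inf: "infinite (mapping_degrees n Y \<beta> X \<alpha>)"
    using flex unfolding weakly_flexible_def by blast
  obtain z where z: "singular_relcycle n Y {} z" "\<beta> = homologous_rel_set n Y {} z"
    using \<beta> by (auto simp: carrier_relative_homology_group)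
  let ?N = "(\<lambda>d. nat \<bar>d\<bar>) ` mapping_degrees n Y \<beta> X \<alpha>"
  have bound: "integral_l1_seminorm n X (\<alpha> [^]\<^bsub>?G\<^esub> k) \<le> chain_l1_norm z" if kN: "k \<in> ?N" for k
  proof -
    obtain d f where k: "k = nat \<bar>d\<bar>" and f: "continuous_map Y X f"
      and deg: "hom_induced (int n) Y {} X {} f \<beta> = \<alpha> [^]\<^bsub>?G\<^esub> d"
      using kN unfolding mapping_degrees_def by blast
    have "integral_l1_seminorm n X (\<alpha> [^]\<^bsub>?G\<^esub> k) \<le> integral_l1_seminorm n X (\<alpha> [^]\<^bsub>?G\<^esub> d)"
      unfolding k by (rule integral_l1_seminorm_pow_nat_abs_le[OF \<alpha>])
    \<comment> \<open>The pushed-forward cycle represents the multiple by \<open>d\<close>, and its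
      norm is bounded by that of \<open>z\<close>, whatever \<open>f\<close> and \<open>d\<close>
      are.\<close>
    also have "\<dots> \<le> chain_l1_norm (chain_map n f z)"
      using z f deg
      by (intro integral_l1_seminorm_le)
        (auto simp: hom_induced_chain_map intro: singular_relcycle_chain_map)
    also have "\<dots> \<le> chain_l1_norm z"
      by (simp add: chain_l1_norm_chain_map_le)
    finally show ?thesis .
  qed
  \<comment> \<open>Taking absolute values is at most two-to-one, so infinitely many degrees leave
    infinitely many exponents.\<close>
  have "infinite ?N"
  proof
    assume "finite ?N"
    moreover have "mapping_degrees n Y \<beta> X \<alpha> \<subseteq> (\<Union>k\<in>?N. {- int k, int k})"
      by force
    ultimately show False
      using inf finite_subset by blast
  qed
  then have "strict_mono (enumerate ?N)" and "\<And>i. enumerate ?N i \<in> ?N"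
    by (simp_all add: strict_mono_enumerate enumerate_in_set)
  moreover have "Bseq ((\<lambda>d. integral_l1_seminorm n X (\<alpha> [^]\<^bsub>?G\<^esub> d)) \<circ> enumerate ?N)"
    using bound calculation(2) \<alpha>
    by (intro BseqI'[of _ "chain_l1_norm z"]) (simp add: integral_l1_seminorm_nonneg)
  ultimately show ?thesis
    unfolding has_bounded_subsequence_def by blast
qed

section \<open>Realising infinitely many cycles by one cycle\<close>

text \<open>
  Points \<open>(j, x)\<close> of the disjoint union of \<open>m\<close> simplices are encoded as \<open>case_nat (real j) x\<close>.
  Two of them are identified when all the families agree on them; the initial topology of the
  maps to \<open>X\<close> then makes both the simplices and these maps continuous.
\<close>
lemma joint_simplex_space:
  fixes \<sigma> :: "'i \<Rightarrow> nat \<Rightarrow> (nat \<Rightarrow> real) \<Rightarrow> 'a"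
  assumes \<sigma>: "\<And>i j. i \<in> I \<Longrightarrow> j < m \<Longrightarrow> singular_simplex n X (\<sigma> i j)"
  obtains Y :: "(nat \<Rightarrow> real) topology" and \<tau> F where
    "\<And>j. j < m \<Longrightarrow> singular_simplex n Y (\<tau> j)"
    "\<And>i. i \<in> I \<Longrightarrow> continuous_map Y X (F i)"
    "\<And>i j. i \<in> I \<Longrightarrow> j < m \<Longrightarrow> simplex_map n (F i) (\<tau> j) = \<sigma> i j"
    "\<And>j j' x x'. \<lbrakk>x \<in> standard_simplex n; x' \<in> standard_simplex n;
        \<forall>i\<in>I. \<sigma> i j x = \<sigma> i j' x'\<rbrakk> \<Longrightarrow> \<tau> j x = \<tau> j' x'"
proof -
  define code :: "nat \<Rightarrow> (nat \<Rightarrow> real) \<Rightarrow> nat \<Rightarrow> real" where "code j x = case_nat (real j) x" for j x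
  \<comment> \<open>\<open>g\<close> decodes the simplex index from coordinate 0 and the point from
    the shifted tail, and records the images under all families at once.\<close>
  define g where "g p = (\<lambda>i\<in>I. \<sigma> i (nat \<lfloor>p 0\<rfloor>) (\<lambda>k. p (Suc k)))" for p :: "nat \<Rightarrow> real"
  define S where "S = {code j x | j x. j < m \<and> x \<in> standard_simplex n}"
  \<comment> \<open>\<open>q\<close> chooses one representative in \<open>S\<close> for each value
    of \<open>g\<close> on \<open>S\<close>, so the quotient is realised inside the type
    \<open>nat => real\<close>.\<close>
  define q where "q p = inv_into S g (g p)" for p
  define Y where "Y = pullback_topology (q ` S) g (product_topology (\<lambda>_. X) I)"
  define \<tau> where "\<tau> j = (\<lambda>x\<in>standard_simplex n. q (code j x))" for j
  have g_code: "g (code j x) = (\<lambda>i\<in>I. \<sigma> i j x)" for j x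
    by (simp add: g_def code_def)
  have g_q: "g (q p) = g p" if "p \<in> S" for p
    using that by (simp add: q_def f_inv_into_f)
  have g_\<tau>: "g (\<tau> j x) = (\<lambda>i\<in>I. \<sigma> i j x)" if "j < m" "x \<in> standard_simplex n" for j x
  proof -
    have "code j x \<in> S"
      using that by (auto simp: S_def)
    then show ?thesis
      using that by (simp add: \<tau>_def g_q g_code)
  qed
  let ?\<Delta> = "subtopology (powertop_real UNIV) (standard_simplex n)"
  show ?thesis
  proof
    fix j assume j: "j < m"
    \<comment> \<open>Continuity into the pullback topology reduces to that of \<open>g\<close>
      after \<open>\<tau> j\<close>, which is checked coordinatewise in the product.\<close>
    have "continuous_map ?\<Delta> (product_topology (\<lambda>_. X) I) (\<lambda>x. \<lambda>i\<in>I. \<sigma> i j x)"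
      using \<sigma> j by (auto simp: continuous_map_componentwise singular_simplex_def)
    then have "continuous_map ?\<Delta> (product_topology (\<lambda>_. X) I) (g \<circ> \<tau> j)"
      by (rule continuous_map_eq) (simp add: g_\<tau> j)
    then have "continuous_map ?\<Delta> Y (\<tau> j)"
      unfolding Y_def
      by (rule continuous_map_pullback') (use j in \<open>force simp: \<tau>_def S_def\<close>)
    then show "singular_simplex n Y (\<tau> j)"
      by (simp add: singular_simplex_def \<tau>_def)
  next
    fix i assume "i \<in> I"
    then show "continuous_map Y X ((\<lambda>h. h i) \<circ> g)"
      unfolding Y_def by (intro continuous_map_pullback continuous_map_product_projection)
  next
    fix i j assume "i \<in> I" "j < m"
    then show "simplex_map n ((\<lambda>h. h i) \<circ> g) (\<tau> j) = \<sigma> i j"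
      using \<sigma>[of i j]
      by (intro ext) (auto simp: simplex_map_def g_\<tau> singular_simplex_def extensional_def)
  next
    fix j j' x x'
    assume x: "x \<in> standard_simplex n" "x' \<in> standard_simplex n"
      and eq: "\<forall>i\<in>I. \<sigma> i j x = \<sigma> i j' x'"
    have "g (code j x) = g (code j' x')"
      using eq by (auto simp: g_code)
    then show "\<tau> j x = \<tau> j' x'"
      using x by (simp add: \<tau>_def q_def)
  qed
qed

text \<open>Sending each face of an \<open>s j\<close> to the corresponding face of
  \<open>t j\<close> is well defined by the first hypothesis. Its linear extension carries the
  boundary of the first chain to that of the second, hence zero to zero.\<close>

lemma chain_boundary_eq_0_transfer:
  fixes m :: nat
  assumes faces: "\<And>j k j' k'. \<lbrakk>j < m; k \<le> n; j' < m; k' \<le> n;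
      singular_face n k (s j) = singular_face n k' (s j')\<rbrakk>
      \<Longrightarrow> singular_face n k (t j) = singular_face n k' (t j')"
    and zero: "chain_boundary n (\<Sum>j<m. frag_cmul (a j) (frag_of (s j))) = 0"
  shows "chain_boundary n (\<Sum>j<m. frag_cmul (a j) (frag_of (t j))) = 0"
proof (cases "n = 0")
  case True
  then show ?thesis by (simp add: chain_boundary_def)
next
  case False
  \<comment> \<open>\<open>sel\<close> names a face by one of its positions \<open>(j, k)\<close>;
    by \<open>faces\<close>, the value of \<open>\<phi>\<close> does not depend on this
    choice.\<close>
  define sel where "sel u = (SOME (j, k). j < m \<and> k \<le> n \<and> u = singular_face n k (s j))" for u
  define \<phi> where "\<phi> u = singular_face n (snd (sel u)) (t (fst (sel u)))" for u
  have \<phi>: "\<phi> (singular_face n k (s j)) = singular_face n k (t j)" if "j < m" "k \<le> n" for j k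
  proof -
    let ?P = "\<lambda>(j', k'). j' < m \<and> k' \<le> n \<and> singular_face n k (s j) = singular_face n k' (s j')"
    obtain j' k' where sel: "sel (singular_face n k (s j)) = (j', k')"
      by fastforce
    have "?P (sel (singular_face n k (s j)))"
      unfolding sel_def by (rule someI[of ?P "(j, k)"]) (use that in simp)
    then have "j' < m" "k' \<le> n" "singular_face n k (s j) = singular_face n k' (s j')"
      by (simp_all add: sel)
    then have "singular_face n k (t j) = singular_face n k' (t j')"
      using faces that by blast
    then show ?thesis
      unfolding \<phi>_def sel by simp
  qed
  have boundary: "chain_boundary n (\<Sum>j<m. frag_cmul (a j) (frag_of (s j)))
      = (\<Sum>j<m. frag_cmul (a j) (\<Sum>k\<le>n. frag_cmul ((-1) ^ k) (frag_of (singular_face n k (s j)))))"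
    using False by (simp add: chain_boundary_sum chain_boundary_cmul chain_boundary_of)
  have "chain_boundary n (\<Sum>j<m. frag_cmul (a j) (frag_of (t j)))
      = (\<Sum>j<m. frag_cmul (a j) (\<Sum>k\<le>n. frag_cmul ((-1) ^ k) (frag_of (singular_face n k (t j)))))"
    using False by (simp add: chain_boundary_sum chain_boundary_cmul chain_boundary_of)
  also have "\<dots> = frag_extend (frag_of \<circ> \<phi>) (chain_boundary n (\<Sum>j<m. frag_cmul (a j) (frag_of (s j))))"
    by (simp add: boundary frag_extend_sum frag_extend_cmul \<phi>)
  finally show ?thesis
    using zero by simp
qed

text \<open>Integrality enters here: each nonzero coefficient contributes at least 1 to the norm, so
  the norm bounds the number of simplices as well as the coefficients.\<close>

lemma chain_bounded_expansion:
  fixes c :: "'a chain"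
  assumes "chain_l1_norm c \<le> int C"
  obtains m a s where "m \<le> C" "a \<in> {..<m} \<rightarrow>\<^sub>E {- int C..int C}"
    "\<And>j. j < m \<Longrightarrow> s j \<in> Poly_Mapping.keys c"
    "c = (\<Sum>j<m. frag_cmul (a j) (frag_of (s j)))"
proof -
  let ?K = "Poly_Mapping.keys c"
  obtain s where s: "bij_betw s {0..<card ?K} ?K"
    using ex_bij_betw_nat_finite[of ?K] by auto
  have coeff: "\<bar>Poly_Mapping.lookup c \<sigma>\<bar> \<le> int C" if "\<sigma> \<in> ?K" for \<sigma>
    using member_le_sum[OF that, of "\<lambda>\<sigma>. \<bar>Poly_Mapping.lookup c \<sigma>\<bar>"] assms
    by (simp add: chain_l1_norm_def)
  \<comment> \<open>The coefficient function is restricted to the indices below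
    \<open>card ?K\<close>, so that it ranges over a finite extensional function space.\<close>
  show ?thesis
  proof (rule that[of "card ?K" "\<lambda>j\<in>{..<card ?K}. Poly_Mapping.lookup c (s j)" s])
    have "int (card ?K) = (\<Sum>\<sigma>\<in>?K. 1)"
      by simp
    also have "\<dots> \<le> chain_l1_norm c"
      unfolding chain_l1_norm_def by (intro sum_mono) (simp add: in_keys_iff)
    finally show "card ?K \<le> C"
      using assms by simp
    show key: "s j \<in> ?K" if "j < card ?K" for j
      using bij_betwE[OF s] that by simp
    show "(\<lambda>j\<in>{..<card ?K}. Poly_Mapping.lookup c (s j))
        \<in> {..<card ?K} \<rightarrow>\<^sub>E {- int C..int C}"
    proof (rule restrict_PiE_iff[THEN iffD2], intro ballI)
      fix j assume "j \<in> {..<card ?K}"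
      then show "Poly_Mapping.lookup c (s j) \<in> {- int C..int C}"
        using coeff[OF key, of j] by (auto simp: abs_le_iff)
    qed
    have "c = (\<Sum>\<sigma>\<in>?K. frag_cmul (Poly_Mapping.lookup c \<sigma>) (frag_of \<sigma>))"
      using frag_expansion[of c] by (simp add: frag_extend_def)
    also have "\<dots> = (\<Sum>j\<in>{0..<card ?K}. frag_cmul (Poly_Mapping.lookup c (s j)) (frag_of (s j)))"
      by (rule sum.reindex_bij_betw[OF s, symmetric])
    finally show "c = (\<Sum>j<card ?K. frag_cmul
        ((\<lambda>j\<in>{..<card ?K}. Poly_Mapping.lookup c (s j)) j) (frag_of (s j)))"
      by (simp add: lessThan_atLeast0)
  qed
qed

text \<open>The pigeonhole principle selects cycles with equal coefficients and equal coincidences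
  of faces; these coincidences are what makes the glued chain closed.\<close>

lemma bounded_cycles_common_source:
  fixes c :: "'i \<Rightarrow> 'a chain"
  assumes D: "infinite D"
    and cycle: "\<And>d. d \<in> D \<Longrightarrow> singular_relcycle n X {} (c d)"
    and norm: "\<And>d. d \<in> D \<Longrightarrow> chain_l1_norm (c d) \<le> int C"
  obtains I and Y :: "(nat \<Rightarrow> real) topology" and z F where
    "I \<subseteq> D" "infinite I" "singular_relcycle n Y {} z"
    "\<And>d. d \<in> I \<Longrightarrow> continuous_map Y X (F d)"
    "\<And>d. d \<in> I \<Longrightarrow> chain_map n (F d) z = c d"
proof -
  have "\<forall>d\<in>D. \<exists>t. case t of (m, a, s) \<Rightarrow>
      m \<le> C \<and> a \<in> {..<m} \<rightarrow>\<^sub>E {- int C..int C}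
      \<and> (\<forall>j<m. s j \<in> Poly_Mapping.keys (c d))
      \<and> c d = (\<Sum>j<m. frag_cmul (a j) (frag_of (s j)))"
  proof
    fix d assume "d \<in> D"
    show "\<exists>t. case t of (m, a, s) \<Rightarrow>
        m \<le> C \<and> a \<in> {..<m} \<rightarrow>\<^sub>E {- int C..int C}
        \<and> (\<forall>j<m. s j \<in> Poly_Mapping.keys (c d))
        \<and> c d = (\<Sum>j<m. frag_cmul (a j) (frag_of (s j)))"
    proof (rule chain_bounded_expansion[OF norm[OF \<open>d \<in> D\<close>]])
      fix m a s
      assume "m \<le> C" "a \<in> {..<m} \<rightarrow>\<^sub>E {- int C..int C}"
        "\<And>j. j < m \<Longrightarrow> s j \<in> Poly_Mapping.keys (c d)"
        "c d = (\<Sum>j<m. frag_cmul (a j) (frag_of (s j)))"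
      then show ?thesis
        by (intro exI[of _ "(m, a, s)"]) (unfold case_prod_conv, blast)
    qed
  qed
  then obtain t where t: "\<forall>d\<in>D. case t d of (m, a, s) \<Rightarrow>
      m \<le> C \<and> a \<in> {..<m} \<rightarrow>\<^sub>E {- int C..int C}
      \<and> (\<forall>j<m. s j \<in> Poly_Mapping.keys (c d))
      \<and> c d = (\<Sum>j<m. frag_cmul (a j) (frag_of (s j)))"
    unfolding bchoice_iff by blast
  define m where "m d = fst (t d)" for d
  define a where "a d = fst (snd (t d))" for d
  define s where "s d = snd (snd (t d))" for d
  have m: "m d \<le> C"
    and a: "a d \<in> {..<m d} \<rightarrow>\<^sub>E {- int C..int C}"
    and s: "\<And>j. j < m d \<Longrightarrow> s d j \<in> Poly_Mapping.keys (c d)"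
    and c: "c d = (\<Sum>j<m d. frag_cmul (a d j) (frag_of (s d j)))" if "d \<in> D" for d
    using bspec[OF t that] unfolding m_def a_def s_def case_prod_beta by blast+
  have simplex: "singular_simplex n X (s d j)" if "d \<in> D" "j < m d" for d j
    using s[OF that] cycle[OF that(1)] unfolding singular_relcycle singular_chain_def by blast
  \<comment> \<open>The pattern of equal faces determines which terms of the boundary can
    cancel.\<close>
  define pat where "pat d = {(j, k, j', k'). j < m d \<and> k \<le> n \<and> j' < m d \<and> k' \<le> n
      \<and> singular_face n k (s d j) = singular_face n k' (s d j')}" for d
  let ?T = "\<lambda>d. (m d, a d, pat d)"
  have "?T ` D \<subseteq> (\<Union>l\<le>C. {l} \<times> ({..<l} \<rightarrow>\<^sub>E {- int C..int C})
      \<times> Pow ({..<C} \<times> {..n} \<times> {..<C} \<times> {..n}))"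
  proof (rule image_subsetI)
    fix d assume d: "d \<in> D"
    have "pat d \<subseteq> {..<C} \<times> {..n} \<times> {..<C} \<times> {..n}"
      using m[OF d] by (auto simp: pat_def)
    then show "?T d \<in> (\<Union>l\<le>C. {l} \<times> ({..<l} \<rightarrow>\<^sub>E {- int C..int C})
      \<times> Pow ({..<C} \<times> {..n} \<times> {..<C} \<times> {..n}))"
      using m[OF d] a[OF d] by blast
  qed
  moreover have "finite (\<Union>l\<le>C. {l} \<times> ({..<l} \<rightarrow>\<^sub>E {- int C..int C})
      \<times> Pow ({..<C} \<times> {..n} \<times> {..<C} \<times> {..n}))"
    by (intro finite_UN_I finite_cartesian_product finite_PiE) auto
  ultimately have "finite (?T ` D)"
    by (rule finite_subset)
  then obtain e where e: "e \<in> D" and inf: "infinite {d \<in> D. ?T d = ?T e}"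
    using pigeonhole_infinite[OF D] by blast
  define I where "I = {d \<in> D. ?T d = ?T e}"
  have I: "d \<in> D" "m d = m e" "a d = a e" "pat d = pat e" if "d \<in> I" for d
    using that by (auto simp: I_def)
  obtain Y :: "(nat \<Rightarrow> real) topology" and \<tau> F where
    \<tau>: "\<And>j. j < m e \<Longrightarrow> singular_simplex n Y (\<tau> j)" and
    F: "\<And>d. d \<in> I \<Longrightarrow> continuous_map Y X (F d)" and
    F\<tau>: "\<And>d j. d \<in> I \<Longrightarrow> j < m e \<Longrightarrow> simplex_map n (F d) (\<tau> j) = s d j" and
    glue: "\<And>j j' x x'. \<lbrakk>x \<in> standard_simplex n; x' \<in> standard_simplex n;
        \<forall>d\<in>I. s d j x = s d j' x'\<rbrakk> \<Longrightarrow> \<tau> j x = \<tau> j' x'"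
  proof (rule joint_simplex_space[of I "m e" n X s])
    show "singular_simplex n X (s d j)" if "d \<in> I" "j < m e" for d j
      using that I simplex by simp
  qed (rule that)
  \<comment> \<open>The coefficients of \<open>e\<close> are those of every \<open>d\<close> in
    \<open>I\<close>, so one chain can map to all the \<open>c d\<close>.\<close>
  define z where "z = (\<Sum>j<m e. frag_cmul (a e j) (frag_of (\<tau> j)))"
  show ?thesis
  proof
    show "I \<subseteq> D" "infinite I"
      using inf by (auto simp: I_def)
    \<comment> \<open>For \<open>n = 0\<close> there are no genuine faces, hence the restriction to
      positive \<open>n\<close>; in degree 0 the boundary vanishes by definition.\<close>
    have faces: "singular_face n k (\<tau> j) = singular_face n k' (\<tau> j')"
      if jk: "j < m e" "k \<le> n" "j' < m e" "k' \<le> n" and n: "n > 0"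
        and eq: "singular_face n k (s e j) = singular_face n k' (s e j')" for j k j' k'
    proof (rule ext)
      fix x
      have "\<tau> j (simplical_face k x) = \<tau> j' (simplical_face k' x)"
        if x: "x \<in> standard_simplex (n - Suc 0)"
      proof (intro glue ballI)
        fix d assume d: "d \<in> I"
        \<comment> \<open>Gluing requires agreement for every \<open>d\<close> in \<open>I\<close>;
          the shared pattern transports it from \<open>e\<close> to \<open>d\<close>.\<close>
        have "(j, k, j', k') \<in> pat d"
          using I(4)[OF d] jk eq by (simp add: pat_def)
        then have "singular_face n k (s d j) = singular_face n k' (s d j')"
          by (simp add: pat_def)
        then have "singular_face n k (s d j) x = singular_face n k' (s d j') x"
          by simp
        then show "s d j (simplical_face k x) = s d j' (simplical_face k' x)"
          using x by (simp add: singular_face_def)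
      qed (use x jk n in \<open>auto intro!: simplical_face_in_standard_simplex\<close>)
      then show "singular_face n k (\<tau> j) x = singular_face n k' (\<tau> j') x"
        by (simp add: singular_face_def)
    qed
    have "chain_boundary n z = 0"
    proof (cases "n = 0")
      case False
      have "chain_boundary n (\<Sum>j<m e. frag_cmul (a e j) (frag_of (s e j))) = 0"
        using cycle[OF e] c[OF e] by (simp add: singular_cycle)
      then show ?thesis
        unfolding z_def by (rule chain_boundary_eq_0_transfer[rotated]) (rule faces, use False in simp_all)
    qed (simp add: chain_boundary_def)
    moreover have "singular_chain n Y z"
      unfolding z_def by (intro singular_chain_sum singular_chain_cmul)
        (simp add: singular_chain_of \<tau>)
    ultimately show "singular_relcycle n Y {} z"
      by (simp add: singular_cycle)
    show "continuous_map Y X (F d)" if "d \<in> I" for d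
      using F that .
    show "chain_map n (F d) z = c d" if d: "d \<in> I" for d
    proof -
      have "c d = (\<Sum>j<m e. frag_cmul (a e j) (frag_of (s d j)))"
        using c[OF I(1)[OF d]] unfolding I(2,3)[OF d] .
      then show ?thesis
        using d by (simp add: z_def chain_map_sum F\<tau>)
    qed
  qed
qed

section \<open>From bounded norms to weak flexibility\<close>

lemma bounded_subsequence_imp_weakly_flexible:
  assumes \<alpha>: "\<alpha> \<in> carrier (homology_group (int n) X)"
    and bounded: "has_bounded_subsequence
           (\<lambda>d. integral_l1_seminorm n X (\<alpha> [^]\<^bsub>homology_group (int n) X\<^esub> d))"
  shows "weakly_flexible TYPE(nat \<Rightarrow> real) n X \<alpha>"
proof -
  let ?G = "homology_group (int n) X"
  interpret group ?G by simp
  obtain r :: "nat \<Rightarrow> nat" and K where r: "strict_mono r"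
    and K: "\<And>k. \<bar>integral_l1_seminorm n X (\<alpha> [^]\<^bsub>?G\<^esub> r k)\<bar> \<le> K"
    using bounded unfolding has_bounded_subsequence_def Bseq_def by auto
  \<comment> \<open>Adding 1 to \<open>K\<close> gives strict room above the infimum, and rounding
    up gives one natural bound for all cycles.\<close>
  have "\<exists>c. singular_relcycle n X {} c \<and> homologous_rel_set n X {} c = \<alpha> [^]\<^bsub>?G\<^esub> d
      \<and> chain_l1_norm c \<le> int (nat \<lceil>K + 1\<rceil>)" if d: "d \<in> range r" for d
  proof -
    have "integral_l1_seminorm n X (\<alpha> [^]\<^bsub>?G\<^esub> d) < K + 1"
    proof -
      obtain k where "d = r k"
        using d by blast
      then show ?thesis
        using K[of k] by simp
    qed
    then obtain c where "singular_relcycle n X {} c" "homologous_rel_set n X {} c = \<alpha> [^]\<^bsub>?G\<^esub> d"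
      "real_of_int (chain_l1_norm c) < K + 1"
      using integral_l1_seminorm_lessD[OF nat_pow_closed[OF \<alpha>]] by metis
    then show ?thesis
      by (intro exI[of _ c]) linarith
  qed
  then obtain c where c: "\<And>d. d \<in> range r \<Longrightarrow> singular_relcycle n X {} (c d)"
    "\<And>d. d \<in> range r \<Longrightarrow> homologous_rel_set n X {} (c d) = \<alpha> [^]\<^bsub>?G\<^esub> d"
    "\<And>d. d \<in> range r \<Longrightarrow> chain_l1_norm (c d) \<le> int (nat \<lceil>K + 1\<rceil>)"
    by metis
  have "infinite (range r)"
    using r by (simp add: range_inj_infinite strict_mono_imp_inj_on)
  then obtain I and Y :: "(nat \<Rightarrow> real) topology" and z F where
    I: "I \<subseteq> range r" "infinite I" and z: "singular_relcycle n Y {} z" and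
    F: "\<And>d. d \<in> I \<Longrightarrow> continuous_map Y X (F d)" "\<And>d. d \<in> I \<Longrightarrow> chain_map n (F d) z = c d"
    using bounded_cycles_common_source[of "range r" n X c] c by metis
  let ?\<beta> = "homologous_rel_set n Y {} z"
  \<comment> \<open>\<open>F d\<close> sends the class of \<open>z\<close> to that of
    \<open>c d\<close>, the multiple of \<open>\<alpha>\<close> by \<open>d\<close>, so every
    \<open>d\<close> in \<open>I\<close> is a degree.\<close>
  have "int ` I \<subseteq> mapping_degrees n Y ?\<beta> X \<alpha>"
    unfolding mapping_degrees_def
    using I z F c(2) by (auto simp: hom_induced_chain_map int_pow_int intro!: exI)
  then have "infinite (mapping_degrees n Y ?\<beta> X \<alpha>)"
    using I(2) finite_subset finite_imageD inj_on_of_nat by blast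
  then show ?thesis
    using z unfolding weakly_flexible_def carrier_relative_homology_group by blast
qed

text \<open>The gluing construction always yields a space over \<open>nat => real\<close>; the
  second conjunct covers spaces over any other type, so no choice of \<open>Y\<close> is
  missed.\<close>

theorem theorem5p1:
  fixes X :: "'a topology" and n :: nat and \<alpha> :: "'a chain set"
  assumes "\<alpha> \<in> carrier (homology_group (int n) X)"
  shows "(weakly_flexible TYPE(nat \<Rightarrow> real) n X \<alpha> \<longleftrightarrow>
            has_bounded_subsequence
              (\<lambda>d. integral_l1_seminorm n X (\<alpha> [^]\<^bsub>homology_group (int n) X\<^esub> d)))
       \<and> (weakly_flexible TYPE('y) n X \<alpha> \<longrightarrow>
            has_bounded_subsequence
              (\<lambda>d. integral_l1_seminorm n X (\<alpha> [^]\<^bsub>homology_group (int n) X\<^esub> d)))"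
  using weakly_flexible_imp_bounded_subsequence[OF assms, where ?'y = "nat \<Rightarrow> real"]
    weakly_flexible_imp_bounded_subsequence[OF assms, where ?'y = 'y]
    bounded_subsequence_imp_weakly_flexible[OF assms] by blast

end
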